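(* Let $\langle k\rangle=(k,k-1,\dots,1)\in S_k$ and $\Psi(x,y)=\sum_{k\ge1}G_{\langle k\rangle}(x)y^k$. Then $$\Psi(x,y)=\frac{(1-x)(1-xy)-\sqrt{(1-x)^2(1-xy)^2-4x^2(1-x)y}}{2x}.$$
   Context: An occurrence of a pattern $\tau\in S_k$ in $\alpha\in S_n$ is a choice of indices $1\le i_1<\dots<i_k\le n$ with $(\alpha_{i_1},\dots,\alpha_{i_k})$ order-isomorphic to $\tau$; $\alpha$ contains $\tau$ exactly once if there is exactly one occurrence, and avoids $\tau$ if there is none. $g_\tau(n)$ is the number of permutations in $S_n$ that avoid $132$ and contain $\tau$ exactly once, and $G_\tau(x)=\sum_{n\ge0}g_\tau(n)x^n$. *)

theory Defs
  imports
    "HOL-Computational_Algebra.Computational_Algebra"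
    "HOL-Combinatorics.Multiset_Permutations"
begin

text \<open>
  Permutations of \<open>{1..n}\<close> are written in one-line notation, i.e. as the elements of
  \<^term>\<open>permutations_of_set {1..n}\<close>.
\<close>

definition order_isomorphic :: "nat list \<Rightarrow> nat list \<Rightarrow> bool" where
  "order_isomorphic u v \<longleftrightarrow>
     length u = length v \<and>
     (\<forall>a<length u. \<forall>b<length u. u ! a < u ! b \<longleftrightarrow> v ! a < v ! b)"

text \<open>
  A choice of indices \<open>i\<^sub>1 < \<dots> < i\<^sub>k\<close> is encoded as the set of these indices (counted
  from 0); \<^const>\<open>nths\<close> extracts the corresponding subword in increasing order of indices.
\<close>

definition occurrences :: "nat list \<Rightarrow> nat list \<Rightarrow> nat set set" where
  "occurrences \<tau> \<alpha> = {I. I \<subseteq> {..<length \<alpha>} \<and> order_isomorphic (nths \<alpha> I) \<tau>}"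

definition avoids :: "nat list \<Rightarrow> nat list \<Rightarrow> bool" where
  "avoids \<alpha> \<tau> \<longleftrightarrow> occurrences \<tau> \<alpha> = {}"

definition contains_exactly_once :: "nat list \<Rightarrow> nat list \<Rightarrow> bool" where
  "contains_exactly_once \<alpha> \<tau> \<longleftrightarrow> (\<exists>!I. I \<in> occurrences \<tau> \<alpha>)"

definition g132 :: "nat list \<Rightarrow> nat \<Rightarrow> nat" where
  "g132 \<tau> n = card {\<alpha> \<in> permutations_of_set {1..n}.
                   avoids \<alpha> [1, 3, 2] \<and> contains_exactly_once \<alpha> \<tau>}"

definition G132 :: "nat list \<Rightarrow> real fps" where
  "G132 \<tau> = Abs_fps (\<lambda>n. of_nat (g132 \<tau> n))"

definition decreasing_pattern :: "nat \<Rightarrow> nat list" where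
  "decreasing_pattern k = rev [1..<Suc k]"

text \<open>
  Bivariate series are power series in \<open>Y\<close> whose coefficients are Laurent series in \<open>X\<close>; the
  coefficients then form a field, so that division by \<open>2 * X\<close> is the library's division.
\<close>

definition X :: "real fls fps" where
  "X = fps_const fls_X"

definition Y :: "real fls fps" where
  "Y = fps_X"

definition \<Psi> :: "real fls fps" where
  "\<Psi> = Abs_fps (\<lambda>k. if k \<ge> 1 then fps_to_fls (G132 (decreasing_pattern k)) else 0)"

text \<open>
  The square root of a bivariate power series with positive constant term: the branch with
  positive constant term. \<^const>\<open>fps_radical\<close> takes as argument a choice of roots
  for the coefficient at \<open>Y\<^sup>0\<close>. That coefficient is a power series in \<open>X\<close>, and its root is
  again computed by \<^const>\<open>fps_radical\<close>, now based on the real \<^const>\<open>root\<close>.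
\<close>

definition fps_sqrt :: "real fls fps \<Rightarrow> real fls fps" where
  "fps_sqrt D = fps_radical (\<lambda>n c. fps_to_fls (fps_radical root n (fls_regpart c))) 2 D"

lemma fps_sqrt_eqI:
  assumes "S ^ 2 = D" "S $ 0 = fps_to_fls s" "s $ 0 > 0"
  shows "fps_sqrt D = S"
proof -
  have s2: "fps_radical root 2 (s ^ 2) = s"
    using radical_power[of root 1 s] assms(3)
    by (simp add: numeral_2_eq_2 real_root_power_cancel del: power_Suc)
  have D0: "D $ 0 = fps_to_fls (s ^ 2)"
    using assms(1,2) by (auto simp: fps_to_fls_power fps_power_zeroth)
  let ?r = "\<lambda>n c. fps_to_fls (fps_radical root n (fls_regpart c)) :: real fls"
  have r: "?r 2 (D $ 0) = S $ 0"
    using D0 s2 assms(2) by simp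
  have nz: "S $ 0 \<noteq> 0" using assms(2,3) by auto
  have "?r (Suc 1) (D $ 0) ^ Suc 1 = D $ 0"
    using r assms(1) by (auto simp: numeral_2_eq_2 fps_power_zeroth simp del: power_Suc)
  moreover have "D $ 0 \<noteq> 0" using assms(1) nz by (auto simp: fps_power_zeroth)
  ultimately have "S ^ Suc 1 = D \<longleftrightarrow> S = fps_radical ?r (Suc 1) D"
    using r by (intro radical_unique) (auto simp: numeral_2_eq_2)
  thus ?thesis using assms(1) by (simp add: fps_sqrt_def numeral_2_eq_2)
qed

end

theory Submission
  imports Defs "HOL-Library.Sublist"
begin

text \<open>
  Let \<open>P\<^sub>\<alpha>(y)\<close> count the decreasing subsequences of \<open>\<alpha>\<close> by length. If some decreasing
  subsequence is longer than \<open>k \<ge> 1\<close>, there are at least two of length \<open>k\<close>; hence \<open>\<alpha>\<close> contains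
  \<open>\<langle>k\<rangle>\<close> exactly once iff \<open>P\<^sub>\<alpha>\<close> is monic of degree \<open>k\<close>. A nonempty 132-avoider is \<open>a m b\<close> with
  \<open>m\<close> the maximum and every entry of \<open>a\<close> above every entry of \<open>b\<close>, which gives
  \<open>P\<^sub>\<alpha> = (P\<^sub>a + y) P\<^sub>b\<close>. Since the linear coefficient of \<open>P\<^sub>a\<close> is the length of \<open>a\<close>, adding \<open>y\<close>
  changes neither degree nor leading coefficient unless \<open>a\<close> has length at most 1. These two
  exceptions give \<open>\<Psi> = x (\<Psi> + y - x y) (1 + \<Psi>)\<close>, a quadratic equation for \<open>\<Psi>\<close>.
\<close>

section \<open>Decreasing subsequences and their counting polynomial\<close>

text \<open>Sets of values instead of index sets: cutting a permutation into blocks then becomes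
  intersecting with the value sets of the blocks, with no shift of positions.\<close>

definition decreasing_subsets :: "nat list \<Rightarrow> nat set set" where
  "decreasing_subsets \<alpha> = {S. S \<subseteq> set \<alpha> \<and> sorted_wrt (>) (filter (\<lambda>x. x \<in> S) \<alpha>)}"

text \<open>This is \<open>P_\<alpha>(y)\<close>. Coefficients are natural numbers, so that a
  product of leading coefficients equals 1 only if both factors do.\<close>

definition decreasing_poly :: "nat list \<Rightarrow> nat poly" where
  "decreasing_poly \<alpha> = (\<Sum>S\<in>decreasing_subsets \<alpha>. monom 1 (card S))"

lemma finite_decreasing_subsets [simp]: "finite (decreasing_subsets \<alpha>)"
  by (rule finite_subset[of _ "Pow (set \<alpha>)"]) (auto simp: decreasing_subsets_def)

lemma coeff_decreasing_poly:
  "coeff (decreasing_poly \<alpha>) k = card {S \<in> decreasing_subsets \<alpha>. card S = k}"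
proof -
  have "coeff (decreasing_poly \<alpha>) k = (\<Sum>S\<in>decreasing_subsets \<alpha>. if card S = k then 1 else 0)"
    by (simp add: decreasing_poly_def coeff_sum del: One_nat_def)
  also have "\<dots> = (\<Sum>S\<in>{S \<in> decreasing_subsets \<alpha>. card S = k}. 1)"
    by (rule sum.inter_filter[symmetric]) simp
  finally show ?thesis by simp
qed

lemma decreasing_subsets_mono:
  assumes "S \<in> decreasing_subsets \<alpha>" "T \<subseteq> S"
  shows "T \<in> decreasing_subsets \<alpha>"
proof -
  have "filter (\<lambda>x. x \<in> T) \<alpha> = filter (\<lambda>x. x \<in> T) (filter (\<lambda>x. x \<in> S) \<alpha>)"
    using assms(2) by (auto intro!: filter_cong)
  thus ?thesis using assms
    by (auto simp: decreasing_subsets_def intro: sorted_wrt_filter simp del: filter_filter)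
qed

lemma coeff_decreasing_poly_0: "coeff (decreasing_poly \<alpha>) 0 = 1"
proof -
  \<comment> \<open>\<open>card\<close> is 0 on infinite sets as well; finiteness leaves only the
    empty set.\<close>
  have "finite S" if "S \<in> decreasing_subsets \<alpha>" for S
    using that finite_subset by (auto simp: decreasing_subsets_def)
  hence "{S \<in> decreasing_subsets \<alpha>. card S = 0} = {{}}"
    by (auto simp: decreasing_subsets_def)
  thus ?thesis by (simp add: coeff_decreasing_poly)
qed

lemma decreasing_poly_neq_0 [simp]: "decreasing_poly \<alpha> \<noteq> 0"
  using coeff_decreasing_poly_0[of \<alpha>] by auto

text \<open>Every single entry is a decreasing subsequence. Distinctness matters: a repeated value
  would filter to a list that is not strictly decreasing.\<close>

lemma coeff_decreasing_poly_1:
  assumes "distinct \<alpha>"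
  shows "coeff (decreasing_poly \<alpha>) 1 = length \<alpha>"
proof -
  have 1: "{S \<in> decreasing_subsets \<alpha>. card S = 1} = (\<lambda>x. {x}) ` set \<alpha>"
  proof -
    have "sorted_wrt (>) (filter (\<lambda>y. y = x) \<alpha>)" for x
      using assms by (induction \<alpha>) (auto simp: filter_empty_conv)
    thus ?thesis by (auto simp: decreasing_subsets_def card_1_singleton_iff)
  qed
  show ?thesis unfolding coeff_decreasing_poly 1
    using assms by (simp add: card_image distinct_card)
qed

text \<open>Subsets of a decreasing set are decreasing, so a set of size above \<open>k\<close>
  yields several of size \<open>k\<close>. The bound on \<open>k\<close> matters: the empty set is
  always the only one of size 0.\<close>

lemma coeff_decreasing_poly_eq_1_iff:
  assumes "k \<ge> 1"
  shows "coeff (decreasing_poly \<alpha>) k = 1 \<longleftrightarrow>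
           lead_coeff (decreasing_poly \<alpha>) = 1 \<and> degree (decreasing_poly \<alpha>) = k"
proof
  assume *: "coeff (decreasing_poly \<alpha>) k = 1"
  let ?d = "degree (decreasing_poly \<alpha>)"
  have "k \<le> ?d" using * by (intro le_degree) auto
  moreover have "\<not> k < ?d"
  proof
    assume less: "k < ?d"
    \<comment> \<open>The leading coefficient of a nonzero polynomial is nonzero, so some decreasing
      set attains the degree.\<close>
    have "card {S \<in> decreasing_subsets \<alpha>. card S = ?d} \<noteq> 0"
      unfolding coeff_decreasing_poly[symmetric] by simp
    then obtain S where S: "S \<in> decreasing_subsets \<alpha>" "card S = ?d"
      by (metis (mono_tags, lifting) card.empty empty_Collect_eq)
    obtain T where T: "T \<subseteq> S" "card T = k"
      using less S(2) obtain_subset_with_card_n[of k S] by auto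
    have fin: "finite S" using less S(2) by (metis card.infinite less_zeroE)
    obtain s where s: "s \<in> S" "s \<notin> T"
      using T S(2) less by (metis less_irrefl subsetI subset_antisym)
    obtain t where t: "t \<in> T" using T(2) assms by fastforce
    \<comment> \<open>Exchanging one element of \<open>T\<close> for one of \<open>S\<close> outside
      \<open>T\<close> gives a second subset of size \<open>k\<close>.\<close>
    define T' where "T' = insert s (T - {t})"
    have finT: "finite T" using fin T(1) finite_subset by auto
    have T': "T' \<subseteq> S" "card T' = k" "T' \<noteq> T"
      using s t T assms finT by (auto simp: T'_def card_insert_if)
    have sub: "{T, T'} \<subseteq> {S \<in> decreasing_subsets \<alpha>. card S = k}"
      using T T' S by (auto intro: decreasing_subsets_mono)
    have "card {T, T'} \<le> card {S \<in> decreasing_subsets \<alpha>. card S = k}"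
      by (rule card_mono[OF _ sub]) auto
    thus False using T'(3) * by (simp add: coeff_decreasing_poly)
  qed
  ultimately have "k = ?d" by simp
  thus "lead_coeff (decreasing_poly \<alpha>) = 1 \<and> ?d = k" using * by simp
qed auto

text \<open>Without \<open>m\<close>, a decreasing set is an arbitrary decreasing set of
  \<open>a\<close> joined with one of \<open>b\<close>, because \<open>a\<close> lies above
  \<open>b\<close>. With \<open>m\<close>, nothing of \<open>a\<close> can occur, since it would
  precede a larger entry, and the part in \<open>b\<close> is arbitrary.\<close>

lemma decreasing_poly_split:
  assumes dist: "distinct (a @ m # b)"
    and max: "\<forall>x\<in>set a \<union> set b. x < m"
    and gt: "\<forall>x\<in>set a. \<forall>y\<in>set b. y < x"
  shows "decreasing_poly (a @ m # b) = (decreasing_poly a + monom 1 1) * decreasing_poly b"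
proof -
  let ?D = decreasing_subsets
  \<comment> \<open>\<open>?U\<close> collects the decreasing sets without \<open>m\<close>,
    \<open>?V\<close> those with \<open>m\<close>.\<close>
  let ?U = "(\<lambda>(S, T). S \<union> T) ` (?D a \<times> ?D b)" and ?V = "insert m ` ?D b"
  have mem: "S \<in> ?D (a @ m # b) \<longleftrightarrow> S \<in> ?U \<union> ?V" for S
  proof (cases "S \<subseteq> set (a @ m # b)")
    case True
    define S1 where "S1 = S \<inter> set a"
    define S2 where "S2 = S \<inter> set b"
    have f: "filter (\<lambda>x. x \<in> S) a = filter (\<lambda>x. x \<in> S1) a"
      "filter (\<lambda>x. x \<in> S) b = filter (\<lambda>x. x \<in> S2) b"
      by (auto simp: S1_def S2_def intro!: filter_cong)
    have U: "S \<in> ?U \<longleftrightarrow> m \<notin> S \<and> S1 \<in> ?D a \<and> S2 \<in> ?D b"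
    proof
      assume "S \<in> ?U"
      then obtain A B where AB: "S = A \<union> B" "A \<in> ?D a" "B \<in> ?D b" by auto
      have "S1 = A" "S2 = B" "m \<notin> S"
        using AB dist by (auto simp: S1_def S2_def decreasing_subsets_def)
      thus "m \<notin> S \<and> S1 \<in> ?D a \<and> S2 \<in> ?D b" using AB by simp
    next
      assume *: "m \<notin> S \<and> S1 \<in> ?D a \<and> S2 \<in> ?D b"
      hence "S = (\<lambda>(S, T). S \<union> T) (S1, S2)" using True by (auto simp: S1_def S2_def)
      thus "S \<in> ?U" using * by blast
    qed
    have V: "S \<in> ?V \<longleftrightarrow> m \<in> S \<and> S1 = {} \<and> S2 \<in> ?D b"
    proof
      assume "S \<in> ?V"
      then obtain B where B: "S = insert m B" "B \<in> ?D b" by auto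
      have "S1 = {}" "S2 = B" "m \<in> S"
        using B dist by (auto simp: S1_def S2_def decreasing_subsets_def)
      thus "m \<in> S \<and> S1 = {} \<and> S2 \<in> ?D b" using B by simp
    next
      assume *: "m \<in> S \<and> S1 = {} \<and> S2 \<in> ?D b"
      hence "S = insert m S2" using True by (auto simp: S1_def S2_def)
      thus "S \<in> ?V" using * by blast
    qed
    have sub: "S1 \<subseteq> set a" "S2 \<subseteq> set b" by (auto simp: S1_def S2_def)
    \<comment> \<open>The subword selected by \<open>S\<close> is \<open>F1\<close>, then possibly
      \<open>m\<close>, then \<open>F2\<close>; its monotonicity splits accordingly.\<close>
    define F1 F2 where "F1 = filter (\<lambda>x. x \<in> S1) a" and "F2 = filter (\<lambda>x. x \<in> S2) b"
    have set_F: "set F1 = S1" "set F2 = S2" using sub by (auto simp: F1_def F2_def)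
    have D: "S \<in> ?D (a @ m # b) \<longleftrightarrow> sorted_wrt (>) (F1 @ (if m \<in> S then [m] else []) @ F2)"
      using True by (simp add: decreasing_subsets_def f F1_def F2_def)
    have D12: "S1 \<in> ?D a \<longleftrightarrow> sorted_wrt (>) F1" "S2 \<in> ?D b \<longleftrightarrow> sorted_wrt (>) F2"
      using sub by (simp_all add: decreasing_subsets_def F1_def F2_def)
    have bounds: "\<forall>x\<in>S1. x < m" "\<forall>y\<in>S2. y < m" "\<forall>x\<in>S1. \<forall>y\<in>S2. y < x"
      using sub max gt by blast+
    show ?thesis
    proof (cases "m \<in> S")
      case m: True
      have "S \<in> ?D (a @ m # b) \<longleftrightarrow> S1 = {} \<and> S2 \<in> ?D b"
      proof (cases "S1 = {}")
        case True
        hence "F1 = []" using set_F by simp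
        thus ?thesis using True m bounds(2) by (simp add: D D12 set_F)
      next
        case False
        \<comment> \<open>The entry \<open>x\<close> precedes \<open>m\<close> but is smaller, so
          both sides of the equivalence are false.\<close>
        then obtain x where "x \<in> S1" by blast
        moreover from this have "\<not> m < x" using bounds(1) by (simp add: less_imp_le not_less)
        ultimately show ?thesis using False m by (auto simp: D set_F sorted_wrt_append)
      qed
      thus ?thesis using U V m by simp
    next
      case m: False
      have "S \<in> ?D (a @ m # b) \<longleftrightarrow> S1 \<in> ?D a \<and> S2 \<in> ?D b"
        using m bounds(3) by (simp add: D D12 set_F sorted_wrt_append)
      thus ?thesis using U V m by simp
    qed
  next
    case False
    thus ?thesis by (auto simp: decreasing_subsets_def)
  qed
  hence eq: "?D (a @ m # b) = ?U \<union> ?V" by blast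
  have disj: "?U \<inter> ?V = {}" using dist by (auto simp: decreasing_subsets_def)
  have inj1: "inj_on (\<lambda>(S, T). S \<union> T) (?D a \<times> ?D b)"
  proof (rule inj_onI, clarify)
    fix A B A' B'
    assume *: "A \<in> ?D a" "B \<in> ?D b" "A' \<in> ?D a" "B' \<in> ?D b" "A \<union> B = A' \<union> B'"
    \<comment> \<open>The blocks have disjoint values, so each part is recovered from the union by
      intersection.\<close>
    have "A = (A \<union> B) \<inter> set a" "B = (A \<union> B) \<inter> set b"
      "A' = (A' \<union> B') \<inter> set a" "B' = (A' \<union> B') \<inter> set b"
      using * dist by (auto simp: decreasing_subsets_def)
    thus "A = A' \<and> B = B'" using *(5) by metis
  qed
  have inj2: "inj_on (insert m) (?D b)"
  proof (rule inj_onI)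
    fix A B assume "A \<in> ?D b" "B \<in> ?D b" "insert m A = insert m B"
    moreover from this have "m \<notin> A" "m \<notin> B" using dist by (auto simp: decreasing_subsets_def)
    ultimately show "A = B" by (metis insert_ident)
  qed
  have "decreasing_poly (a @ m # b) =
      (\<Sum>S\<in>?U. monom 1 (card S)) + (\<Sum>S\<in>?V. monom 1 (card S))"
    unfolding decreasing_poly_def eq using disj by (intro sum.union_disjoint) auto
  also have "(\<Sum>S\<in>?U. monom (1::nat) (card S)) =
      (\<Sum>(S, T)\<in>?D a \<times> ?D b. monom 1 (card S) * monom 1 (card T))"
  proof (subst sum.reindex[OF inj1], rule sum.cong[OF refl], clarsimp)
    fix A B assume *: "A \<in> ?D a" "B \<in> ?D b"
    hence "finite A" "finite B" "A \<inter> B = {}"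
      using dist by (auto simp: decreasing_subsets_def intro: finite_subset)
    thus "monom (Suc 0) (card (A \<union> B)) = monom (Suc 0) (card A) * monom (Suc 0) (card B)"
      by (simp add: card_Un_disjoint mult_monom)
  qed
  also have "\<dots> = decreasing_poly a * decreasing_poly b"
    by (simp add: decreasing_poly_def sum_product sum.cartesian_product)
  also have "(\<Sum>S\<in>?V. monom (1::nat) (card S)) = (\<Sum>S\<in>?D b. monom 1 1 * monom 1 (card S))"
  proof (subst sum.reindex[OF inj2], rule sum.cong[OF refl])
    fix B assume "B \<in> ?D b"
    hence "finite B" "m \<notin> B" using dist by (auto simp: decreasing_subsets_def intro: finite_subset)
    thus "((\<lambda>S. monom 1 (card S)) \<circ> insert m) B = monom (1::nat) 1 * monom 1 (card B)"
      by (simp add: mult_monom)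
  qed
  also have "\<dots> = monom 1 1 * decreasing_poly b"
    by (simp add: decreasing_poly_def sum_distrib_left)
  finally show ?thesis by (simp add: algebra_simps)
qed

section \<open>Occurrences of decreasing patterns as decreasing sets of values\<close>

lemma order_isomorphic_decreasing_pattern_iff:
  "order_isomorphic u (decreasing_pattern k) \<longleftrightarrow> length u = k \<and> sorted_wrt (>) u"
proof -
  have nth: "decreasing_pattern k ! i = k - i" if "i < k" for i
    using that by (simp add: decreasing_pattern_def rev_nth del: upt_Suc)
  have len: "length (decreasing_pattern k) = k"
    by (simp add: decreasing_pattern_def del: upt_Suc)
  show ?thesis
  proof (cases "length u = k")
    case True
    have "(\<forall>i<k. \<forall>j<k. u ! i < u ! j \<longleftrightarrow> k - i < k - j) \<longleftrightarrow> (\<forall>i j. i < j \<longrightarrow> j < k \<longrightarrow> u ! j < u ! i)"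
      (is "?L \<longleftrightarrow> ?R")
    proof
      assume L: ?L
      show ?R
      proof (intro allI impI)
        fix i j assume "i < j" "j < k"
        thus "u ! j < u ! i" using L[rule_format, of j i] by simp
      qed
    next
      assume R: ?R
      show ?L
      proof (intro allI impI)
        fix i j assume "i < k" "j < k"
        thus "u ! i < u ! j \<longleftrightarrow> k - i < k - j"
          using R[rule_format, of i j] R[rule_format, of j i]
          by (cases i j rule: linorder_cases) auto
      qed
    qed
    thus ?thesis using True by (simp add: order_isomorphic_def len nth sorted_wrt_iff_nth_less)
  qed (auto simp: order_isomorphic_def len)
qed

text \<open>Bridge between the index sets of \<open>occurrences\<close> and the value sets of
  \<open>decreasing_subsets\<close>: in a distinct list a value determines its position.\<close>

lemma nths_image_nth:
  assumes "distinct \<alpha>" "I \<subseteq> {..<length \<alpha>}"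
  shows "filter (\<lambda>x. x \<in> (!) \<alpha> ` I) \<alpha> = nths \<alpha> I"
proof -
  have "set (nths \<alpha> I) = (!) \<alpha> ` I" using assms(2) by (auto simp: set_nths)
  thus ?thesis using filter_in_nths[OF assms(1), of I] by simp
qed

text \<open>Sending an index set to the set of values it selects is a bijection between the two
  families.\<close>

lemma card_occurrences_decreasing_pattern:
  assumes "distinct \<alpha>"
  shows "card (occurrences (decreasing_pattern k) \<alpha>) = coeff (decreasing_poly \<alpha>) k"
proof -
  have inj: "inj_on ((!) \<alpha>) {..<length \<alpha>}"
    using assms by (auto simp: inj_on_nth)
  have inj': "inj_on ((`) ((!) \<alpha>)) (Pow {..<length \<alpha>})"
    by (rule inj_on_image_Pow[OF inj])
  have rng: "(!) \<alpha> ` {..<length \<alpha>} = set \<alpha>"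
    by (auto simp: set_conv_nth)
  have *: "I \<in> occurrences (decreasing_pattern k) \<alpha> \<longleftrightarrow>
      (!) \<alpha> ` I \<in> {S \<in> decreasing_subsets \<alpha>. card S = k}" if I: "I \<subseteq> {..<length \<alpha>}" for I
  proof -
    have "length (nths \<alpha> I) = card I"
      using I by (simp add: length_nths) (metis (no_types, lifting) Collect_cong Collect_mem_eq lessThan_iff subsetD)
    moreover have "card ((!) \<alpha> ` I) = card I"
      using inj I by (intro card_image) (auto intro: inj_on_subset)
    moreover have "(!) \<alpha> ` I \<subseteq> set \<alpha>" using I rng by blast
    ultimately show ?thesis using I nths_image_nth[OF assms I]
      by (auto simp: occurrences_def decreasing_subsets_def order_isomorphic_decreasing_pattern_iff)
  qed
  have "bij_betw ((`) ((!) \<alpha>)) (occurrences (decreasing_pattern k) \<alpha>)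
          {S \<in> decreasing_subsets \<alpha>. card S = k}"
    unfolding bij_betw_def
  proof
    show "inj_on ((`) ((!) \<alpha>)) (occurrences (decreasing_pattern k) \<alpha>)"
      by (rule inj_on_subset[OF inj']) (auto simp: occurrences_def)
    show "(`) ((!) \<alpha>) ` occurrences (decreasing_pattern k) \<alpha> =
        {S \<in> decreasing_subsets \<alpha>. card S = k}"
    proof (intro subset_antisym subsetI)
      fix S assume "S \<in> (`) ((!) \<alpha>) ` occurrences (decreasing_pattern k) \<alpha>"
      then obtain I where I: "I \<in> occurrences (decreasing_pattern k) \<alpha>" "S = (!) \<alpha> ` I" by blast
      have "I \<subseteq> {..<length \<alpha>}" using I(1) by (simp add: occurrences_def)
      from *[OF this] I show "S \<in> {S \<in> decreasing_subsets \<alpha>. card S = k}" by blast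
    next
      fix S assume S: "S \<in> {S \<in> decreasing_subsets \<alpha>. card S = k}"
      hence "S \<subseteq> (!) \<alpha> ` {..<length \<alpha>}" unfolding rng by (auto simp: decreasing_subsets_def)
      then obtain I where I: "I \<subseteq> {..<length \<alpha>}" "S = (!) \<alpha> ` I" by (meson subset_image_iff)
      thus "S \<in> (`) ((!) \<alpha>) ` occurrences (decreasing_pattern k) \<alpha>" using *[OF I(1)] S by blast
    qed
  qed
  thus ?thesis by (simp add: coeff_decreasing_poly bij_betw_same_card)
qed

lemma occurrences_map_strict_mono:
  assumes "strict_mono f"
  shows "occurrences \<tau> (map f \<alpha>) = occurrences \<tau> \<alpha>"
  by (auto simp: occurrences_def order_isomorphic_def nths_map strict_mono_less[OF assms])

text \<open>Relabelling changes the value sets but not the index sets of occurrences, so the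
  coefficients are compared through the latter.\<close>

lemma decreasing_poly_map_strict_mono:
  assumes "strict_mono f" "distinct \<alpha>"
  shows "decreasing_poly (map f \<alpha>) = decreasing_poly \<alpha>"
proof (rule poly_eqI)
  fix k
  have "distinct (map f \<alpha>)"
    using assms by (simp add: distinct_map strict_mono_imp_inj_on inj_on_subset[of f UNIV])
  thus "coeff (decreasing_poly (map f \<alpha>)) k = coeff (decreasing_poly \<alpha>) k"
    using assms by (simp add: card_occurrences_decreasing_pattern[symmetric] occurrences_map_strict_mono)
qed

section \<open>The shape of a 132-avoider around its maximum\<close>

text \<open>Stated with \<open>subseq\<close> so that occurrences can be cut along an
  append.\<close>

lemma avoids_132_iff:
  "avoids \<alpha> [1, 3, 2] \<longleftrightarrow> (\<forall>x y z. subseq [x, y, z] \<alpha> \<longrightarrow> x < z \<longrightarrow> \<not> z < y)"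
proof -
  have oi: "order_isomorphic u [1, 3, 2] \<longleftrightarrow> (\<exists>x y z. u = [x, y, z] \<and> x < z \<and> z < y)" for u
  proof (cases "length u = 3")
    case True
    then obtain x y z where u: "u = [x, y, z]"
      by (auto simp: length_Suc_conv numeral_3_eq_3)
    show ?thesis unfolding order_isomorphic_def u
      by (simp add: numeral_3_eq_3 numeral_2_eq_2 All_less_Suc) linarith
  qed (auto simp: order_isomorphic_def)
  have "avoids \<alpha> [1, 3, 2] \<longleftrightarrow> (\<nexists>u. subseq u \<alpha> \<and> order_isomorphic u [1, 3, 2])"
  proof -
    have "(\<exists>I. I \<subseteq> {..<length \<alpha>} \<and> order_isomorphic (nths \<alpha> I) [1, 3, 2]) \<longleftrightarrow>
        (\<exists>u. subseq u \<alpha> \<and> order_isomorphic u [1, 3, 2])"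
    proof
      assume "\<exists>u. subseq u \<alpha> \<and> order_isomorphic u [1, 3, 2]"
      then obtain N where N: "order_isomorphic (nths \<alpha> N) [1, 3, 2]"
        by (auto simp: subseq_conv_nths)
      \<comment> \<open>\<open>N\<close> may contain indices beyond the end, which
        \<open>occurrences\<close> forbids; truncating it selects the same subword.\<close>
      have "nths \<alpha> (N \<inter> {..<length \<alpha>}) = nths \<alpha> N"
        unfolding nths_def by (intro arg_cong[where f = "map fst"] filter_cong) (auto dest: set_zip_rightD)
      thus "\<exists>I. I \<subseteq> {..<length \<alpha>} \<and> order_isomorphic (nths \<alpha> I) [1, 3, 2]"
        using N by (intro exI[of _ "N \<inter> {..<length \<alpha>}"]) auto
    qed (auto simp: subseq_conv_nths)
    thus ?thesis unfolding avoids_def occurrences_def by blast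
  qed
  thus ?thesis unfolding oi by blast
qed

text \<open>An entry of \<open>a\<close>, then \<open>m\<close>, then a larger entry of
  \<open>b\<close> form a 132. Conversely, an occurrence inside neither block has its 1 in
  \<open>a\<close> and its 2 in \<open>b\<close>, against the order of the blocks.\<close>

lemma avoids_132_split_iff:
  assumes dist: "distinct (a @ m # b)"
    and max: "\<forall>x\<in>set a \<union> set b. x < m"
  shows "avoids (a @ m # b) [1, 3, 2] \<longleftrightarrow>
    avoids a [1, 3, 2] \<and> avoids b [1, 3, 2] \<and> (\<forall>x\<in>set a. \<forall>y\<in>set b. y < x)" (is "?L \<longleftrightarrow> ?R")
proof
  assume L: ?L
  have sub: "subseq a (a @ m # b)" "subseq b (a @ m # b)"
    by (auto intro: subseq_drop_many)
  have "y < x" if xy: "x \<in> set a" "y \<in> set b" for x y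
  proof -
    have "subseq ([x] @ [m] @ [y]) (a @ [m] @ b)"
      using xy by (intro list_emb_append_mono) (auto simp: subseq_singleton_left)
    hence "\<not> (x < y \<and> y < m)" using L[unfolded avoids_132_iff] by auto
    moreover have "x \<noteq> y" using xy dist by auto
    ultimately show ?thesis using max xy by auto
  qed
  moreover have "avoids c [1, 3, 2]" if "subseq c (a @ m # b)" for c
    using L subseq_order.trans[OF _ that] unfolding avoids_132_iff by blast
  ultimately show ?R using sub by blast
next
  assume R: ?R
  show ?L unfolding avoids_132_iff
  proof (intro allI impI notI)
    fix x y z assume sub: "subseq [x, y, z] (a @ m # b)" and lt: "x < z" "z < y"
    have "set [x, y, z] \<subseteq> set (a @ m # b)"
      using sub by (auto simp only: subseq_conv_nths dest: in_set_nthsD)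
    hence "y \<in> set a \<union> set b \<or> y = m" by auto
    \<comment> \<open>Hence \<open>x < z < y \<le> m\<close>: neither \<open>x\<close> nor
      \<open>z\<close> can be \<open>m\<close>, only \<open>y\<close> can.\<close>
    hence ym: "y \<le> m" using max by (auto simp: less_imp_le)
    \<comment> \<open>The occurrence is cut at the boundary between \<open>a\<close> and
      \<open>m # b\<close>; each side must receive something.\<close>
    obtain us vs where uv: "[x, y, z] = us @ vs" "subseq us a" "subseq vs (m # b)"
      using sub by (auto simp: subseq_append_iff)
    have "us \<noteq> [x, y, z]" using uv(2) R[unfolded avoids_132_iff] lt by blast
    moreover have "us \<noteq> []"
    proof
      assume "us = []"
      hence "subseq [x, y, z] b" using uv lt ym by auto
      thus False using R[unfolded avoids_132_iff] lt by blast
    qed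
    ultimately have "x \<in> set us" "z \<in> set vs" using uv(1)
      by (auto simp: Cons_eq_append_conv)
    hence "x \<in> set a" "z \<in> set (m # b)"
      using uv(2,3) by (auto simp only: subseq_conv_nths dest: in_set_nthsD)
    moreover from this have "z \<in> set b" using lt ym by auto
    ultimately show False using R lt by fastforce
  qed
qed

section \<open>Decomposing avoiders into pairs of shorter ones\<close>

text \<open>The value set is a parameter because the block before the maximum uses an upper interval
  \<open>{Suc m..n}\<close>.\<close>

definition avoiders :: "nat set \<Rightarrow> nat list set" where
  "avoiders A = {\<alpha> \<in> permutations_of_set A. avoids \<alpha> [1, 3, 2]}"

lemma finite_avoiders [simp]: "finite (avoiders A)"
  by (simp add: avoiders_def)

lemma avoids_map_strict_mono:
  "strict_mono f \<Longrightarrow> avoids (map f \<alpha>) \<tau> \<longleftrightarrow> avoids \<alpha> \<tau>"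
  by (simp add: avoids_def occurrences_map_strict_mono)

lemma map_add_avoiders:
  "map (\<lambda>x. x + m) ` avoiders {1..i} = avoiders {Suc m..m + i}" (is "map ?f ` _ = _")
proof -
  have f: "strict_mono ?f" by (simp add: strict_mono_def)
  have img: "?f ` {1..i} = {Suc m..m + i}"
    using image_add_atLeastAtMost'[of m 1 i] by (simp add: add.commute)
  have inj: "inj_on ?f {1..i}" by simp
  have "permutations_of_set {Suc m..m + i} = map ?f ` permutations_of_set {1..i}"
    unfolding img[symmetric] by (rule permutations_of_set_image_inj[OF inj])
  thus ?thesis by (auto simp: avoiders_def avoids_map_strict_mono[OF f])
qed

text \<open>The cut is at the maximum of \<open>B\<close>, or at 0 if \<open>B\<close> is
  empty.\<close>

lemma initial_segment_split:
  fixes A B :: "nat set"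
  assumes "A \<union> B = {1..n}" "\<forall>x\<in>A. \<forall>y\<in>B. y < x"
  obtains m where "m \<le> n" "A = {Suc m..n}" "B = {1..m}"
proof (cases "B = {}")
  case True
  thus ?thesis using assms that[of 0] by auto
next
  case False
  have fin: "finite B" using assms(1) by (metis finite_Un finite_atLeastAtMost)
  define m where "m = Max B"
  have m: "m \<in> B" "\<forall>y\<in>B. y \<le> m" using fin False by (auto simp: m_def)
  have ran: "x \<in> A \<or> x \<in> B \<longleftrightarrow> 1 \<le> x \<and> x \<le> n" for x
    using assms(1) by (metis Un_iff atLeastAtMost_iff)
  \<comment> \<open>As \<open>m\<close> lies in \<open>B\<close>, all of \<open>A\<close> is above
    it, so every value from 1 to \<open>m\<close> must fall into \<open>B\<close>.\<close>
  have A: "m < x" if "x \<in> A" for x using that m(1) assms(2) by blast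
  have "x \<in> A \<longleftrightarrow> x \<in> {Suc m..n}" for x
    using ran[of x] A[of x] m(2)[rule_format, of x] by auto
  moreover have "x \<in> B \<longleftrightarrow> x \<in> {1..m}" for x
    using ran[of x] ran[of m] A[of x] m(1) m(2)[rule_format, of x] by auto
  ultimately show ?thesis using that[of m] m(1) ran[of m] by blast
qed

text \<open>Here \<open>m\<close> is the length of the block after the maximum, which uses the
  values \<open>{1..m}\<close>; the block before it is normalised to start at 1 and is shifted up by
  \<open>m\<close>.\<close>

lemma bij_betw_avoiders_Suc:
  "bij_betw (\<lambda>(m, a, b). map (\<lambda>x. x + m) a @ Suc n # b)
     (SIGMA m:{..n}. avoiders {1..n - m} \<times> avoiders {1..m}) (avoiders {1..Suc n})"
  (is "bij_betw ?f ?S _")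
  unfolding bij_betw_def
proof
  show "inj_on ?f ?S"
  proof (rule inj_onI, clarsimp, goal_cases)
    case (1 m a b m' a' b')
    \<comment> \<open>The upper bound stays in the form \<open>m + (n - m)\<close> to match
      \<open>map_add_avoiders\<close>.\<close>
    have mem: "map (\<lambda>x. x + m) a \<in> avoiders {Suc m..m + (n - m)}"
      "map (\<lambda>x. x + m') a' \<in> avoiders {Suc m'..m' + (n - m')}"
      unfolding map_add_avoiders[symmetric] using 1 by auto
    have notin: "Suc n \<notin> set (map (\<lambda>x. x + m) a)" "Suc n \<notin> set (map (\<lambda>x. x + m') a')"
      using mem 1 by (auto simp del: set_map simp: avoiders_def permutations_of_set_def)
    have notin': "Suc n \<notin> set b"
      using 1 by (auto simp: avoiders_def permutations_of_set_def)
    have eq: "map (\<lambda>x. x + m) a = map (\<lambda>x. x + m') a'" "b = b'"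
      using append_Cons_eq_iff[OF notin(1) notin', of "map (\<lambda>x. x + m') a'" b'] 1 by auto
    \<comment> \<open>The value set \<open>{1..m}\<close> of \<open>b\<close> determines
      \<open>m\<close>.\<close>
    have "m = m'"
      using 1 eq(2) by (auto simp: avoiders_def permutations_of_set_def)
    moreover have "a = a'"
      using eq(1) \<open>m = m'\<close> by (simp add: inj_def)
    ultimately show ?case using eq(2) by simp
  qed
  have "\<alpha> \<in> ?f ` ?S \<longleftrightarrow> \<alpha> \<in> avoiders {1..Suc n}" for \<alpha>
  proof
    assume "\<alpha> \<in> ?f ` ?S"
    then obtain m a b where m: "m \<le> n" "a \<in> map (\<lambda>x. x + m) ` avoiders {1..n - m}"
      "b \<in> avoiders {1..m}" "\<alpha> = a @ Suc n # b" by auto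
    hence a: "a \<in> avoiders {Suc m..n}" unfolding map_add_avoiders by simp
    have "distinct \<alpha>" "set \<alpha> = {1..Suc n}"
      using a m by (auto simp: avoiders_def permutations_of_set_def)
    moreover have "avoids \<alpha> [1, 3, 2]"
      using \<open>distinct \<alpha>\<close> a m unfolding m(4)
      by (subst avoids_132_split_iff) (auto simp: avoiders_def permutations_of_set_def)
    ultimately show "\<alpha> \<in> avoiders {1..Suc n}"
      by (simp add: avoiders_def permutations_of_set_def)
  next
    assume \<alpha>: "\<alpha> \<in> avoiders {1..Suc n}"
    hence d: "distinct \<alpha>" "set \<alpha> = {1..Suc n}" and av: "avoids \<alpha> [1, 3, 2]"
      by (auto simp: avoiders_def permutations_of_set_def)
    have "Suc n \<in> set \<alpha>" using d by simp
    then obtain a b where ab: "\<alpha> = a @ Suc n # b" by (meson split_list)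
    have un: "set a \<union> set b = {1..n}"
    proof -
      have "set a \<union> set b = set \<alpha> - {Suc n}" using d(1) by (auto simp: ab)
      also have "\<dots> = {1..n}" unfolding d(2) by auto
      finally show ?thesis .
    qed
    hence "\<forall>x\<in>set a \<union> set b. x < Suc n" by simp
    note sp = iffD1[OF avoids_132_split_iff[OF d(1)[unfolded ab] this] av[unfolded ab]]
    obtain m where m: "m \<le> n" "set a = {Suc m..n}" "set b = {1..m}"
      using initial_segment_split[OF un] sp by blast
    have "a \<in> avoiders {Suc m..m + (n - m)}" "b \<in> avoiders {1..m}"
      using m d sp by (auto simp: ab avoiders_def permutations_of_set_def)
    then obtain a' where "a' \<in> avoiders {1..n - m}" "a = map (\<lambda>x. x + m) a'"
      unfolding map_add_avoiders[symmetric] by auto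
    hence "\<alpha> = ?f (m, a', b)" "(m, a', b) \<in> ?S" using \<open>b \<in> _\<close> m(1) by (auto simp: ab)
    thus "\<alpha> \<in> ?f ` ?S" by blast
  qed
  thus "?f ` ?S = avoiders {1..Suc n}" by blast
qed

lemma decreasing_poly_avoiders_Suc:
  assumes "m \<le> n" "a \<in> avoiders {1..n - m}" "b \<in> avoiders {1..m}"
  shows "decreasing_poly (map (\<lambda>x. x + m) a @ Suc n # b) =
    (decreasing_poly a + monom 1 1) * decreasing_poly b"
proof -
  let ?a = "map (\<lambda>x. x + m) a"
  have "?a \<in> avoiders {Suc m..m + (n - m)}"
    unfolding map_add_avoiders[symmetric] using assms by auto
  hence "distinct ?a" "set ?a = {Suc m..n}" "distinct b" "set b = {1..m}" "distinct a"
    using assms by (auto simp: avoiders_def permutations_of_set_def simp del: set_map)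
  moreover have "decreasing_poly ?a = decreasing_poly a"
    by (rule decreasing_poly_map_strict_mono) (use \<open>distinct a\<close> in \<open>auto simp: strict_mono_def\<close>)
  ultimately show ?thesis using assms(1)
    by (subst decreasing_poly_split) (auto simp del: set_map)
qed

section \<open>A recurrence for the number of monic polynomials\<close>

text \<open>For \<open>decreasing_poly\<close> and positive \<open>k\<close> this expresses
  containing the pattern of length \<open>k\<close> exactly once, in terms that behave well under
  products.\<close>

definition monic_of_degree :: "nat poly \<Rightarrow> nat \<Rightarrow> bool" where
  "monic_of_degree p k \<longleftrightarrow> lead_coeff p = 1 \<and> degree p = k"

text \<open>Degrees add, and natural leading coefficients multiply to 1 only if both are 1. Only
  \<open>j = degree p\<close> can contribute; the convolution form prepares a product of generating
  functions.\<close>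

lemma of_bool_monic_of_degree_mult:
  assumes "p \<noteq> 0" "q \<noteq> 0"
  shows "(of_bool (monic_of_degree (p * q) k) :: nat) =
    (\<Sum>j\<le>k. of_bool (monic_of_degree p j) * of_bool (monic_of_degree q (k - j)))"
proof -
  let ?c = "of_bool (lead_coeff p = 1 \<and> monic_of_degree q (k - degree p)) :: nat"
  have "(\<Sum>j\<le>k. of_bool (monic_of_degree p j) * of_bool (monic_of_degree q (k - j))) =
      (\<Sum>j\<le>k. if j = degree p then ?c else 0)"
  proof (rule sum.cong[OF refl])
    fix j
    have "monic_of_degree p j \<longleftrightarrow> j = degree p \<and> lead_coeff p = 1"
      by (auto simp only: monic_of_degree_def)
    thus "of_bool (monic_of_degree p j) * of_bool (monic_of_degree q (k - j)) =
        (if j = degree p then ?c else 0)"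
      by simp
  qed
  also have "\<dots> = (if degree p \<le> k then ?c else 0)"
    by simp
  also have "\<dots> = of_bool (monic_of_degree (p * q) k)"
  proof -
    have "lead_coeff (p * q) = 1 \<longleftrightarrow> lead_coeff p = 1 \<and> lead_coeff q = 1"
      by (simp only: lead_coeff_mult nat_mult_eq_1_iff)
    moreover have "degree (p * q) = degree p + degree q"
      using assms by (rule degree_mult_eq)
    ultimately have "monic_of_degree (p * q) k \<longleftrightarrow>
        degree p \<le> k \<and> lead_coeff p = 1 \<and> monic_of_degree q (k - degree p)"
      unfolding monic_of_degree_def by linarith
    thus ?thesis by simp
  qed
  finally show ?thesis ..
qed

definition monic_count :: "nat \<Rightarrow> nat \<Rightarrow> nat" where
  "monic_count n k = (\<Sum>\<alpha>\<in>avoiders {1..n}. of_bool (monic_of_degree (decreasing_poly \<alpha>) k))"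

text \<open>Counts by the factor \<open>P_a + y\<close> that the block before the maximum
  contributes.\<close>

definition shifted_monic_count :: "nat \<Rightarrow> nat \<Rightarrow> nat" where
  "shifted_monic_count n k =
     (\<Sum>\<alpha>\<in>avoiders {1..n}. of_bool (monic_of_degree (decreasing_poly \<alpha> + monom 1 1) k))"

text \<open>Removing the maximum splits both the length and the degree, hence a convolution in both
  indices.\<close>

lemma monic_count_Suc:
  "monic_count (Suc n) k =
     (\<Sum>i\<le>n. \<Sum>j\<le>k. shifted_monic_count i j * monic_count (n - i) (k - j))"
proof -
  let ?P = decreasing_poly
  let ?u = "\<lambda>a j. of_bool (monic_of_degree (?P a + monom 1 1) j) :: nat"
  let ?v = "\<lambda>b j. of_bool (monic_of_degree (?P b) j) :: nat"
  have "monic_count (Suc n) k =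
      (\<Sum>(m, a, b)\<in>(SIGMA m:{..n}. avoiders {1..n - m} \<times> avoiders {1..m}).
        ?v (map (\<lambda>x. x + m) a @ Suc n # b) k)"
    unfolding monic_count_def
    by (subst sum.reindex_bij_betw[OF bij_betw_avoiders_Suc, symmetric])
      (simp only: case_prod_unfold)
  also have "\<dots> = (\<Sum>(m, a, b)\<in>(SIGMA m:{..n}. avoiders {1..n - m} \<times> avoiders {1..m}).
        \<Sum>j\<le>k. ?u a j * ?v b (k - j))"
  proof (rule sum.cong[OF refl], clarify, (simp only: prod.case)?)
    fix m a b assume "m \<le> n" "a \<in> avoiders {1..n - m}" "b \<in> avoiders {1..m}"
    \<comment> \<open>A sum of polynomials over the naturals vanishes only if both summands do, and
      \<open>?P a\<close> has constant coefficient 1.\<close>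
    moreover have "?P a + monom 1 1 \<noteq> 0"
      by (metis add_eq_0_iff_both_eq_0 coeff_0 coeff_add coeff_decreasing_poly_0 one_neq_zero)
    ultimately show "?v (map (\<lambda>x. x + m) a @ Suc n # b) k = (\<Sum>j\<le>k. ?u a j * ?v b (k - j))"
      by (simp only: decreasing_poly_avoiders_Suc of_bool_monic_of_degree_mult
          decreasing_poly_neq_0 not_False_eq_True)
  qed
  also have "\<dots> = (\<Sum>m\<le>n. \<Sum>a\<in>avoiders {1..n - m}. \<Sum>b\<in>avoiders {1..m}. \<Sum>j\<le>k. ?u a j * ?v b (k - j))"
    by (simp add: sum.Sigma[symmetric] sum.cartesian_product[symmetric])
  also have "\<dots> = (\<Sum>m\<le>n. \<Sum>j\<le>k. shifted_monic_count (n - m) j * monic_count m (k - j))"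
  proof (rule sum.cong[OF refl])
    fix m
    have "(\<Sum>a\<in>avoiders {1..n - m}. \<Sum>b\<in>avoiders {1..m}. \<Sum>j\<le>k. ?u a j * ?v b (k - j)) =
      (\<Sum>a\<in>avoiders {1..n - m}. \<Sum>j\<le>k. \<Sum>b\<in>avoiders {1..m}. ?u a j * ?v b (k - j))"
      by (intro sum.cong refl sum.swap)
    also have "\<dots> = (\<Sum>j\<le>k. \<Sum>a\<in>avoiders {1..n - m}. \<Sum>b\<in>avoiders {1..m}. ?u a j * ?v b (k - j))"
      by (rule sum.swap)
    finally show "(\<Sum>a\<in>avoiders {1..n - m}. \<Sum>b\<in>avoiders {1..m}. \<Sum>j\<le>k. ?u a j * ?v b (k - j)) =
        (\<Sum>j\<le>k. shifted_monic_count (n - m) j * monic_count m (k - j))"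
      unfolding shifted_monic_count_def monic_count_def by (simp only: sum_product)
  qed
  \<comment> \<open>Reindexing by \<open>i = n - m\<close>, the length of the block before the
    maximum.\<close>
  also have "\<dots> = (\<Sum>i\<le>n. \<Sum>j\<le>k. shifted_monic_count i j * monic_count (n - i) (k - j))"
    by (rule sum.reindex_bij_witness[of _ "\<lambda>i. n - i" "\<lambda>i. n - i"]) auto
  finally show ?thesis .
qed

section \<open>The effect of adding \<open>y\<close>, and the link to \<open>g132\<close>\<close>

lemma avoiders_0: "avoiders {1..0} = {[]}"
  by (auto simp: avoiders_def avoids_132_iff[unfolded One_nat_def] split: if_splits)

lemma avoiders_1: "avoiders {1..1} = {[1]}"
  by (auto simp: avoiders_def avoids_132_iff[unfolded One_nat_def] split: if_splits)

lemma decreasing_poly_Nil: "decreasing_poly [] = 1"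
  by (simp add: decreasing_poly_def decreasing_subsets_def del: One_nat_def)

lemma decreasing_poly_singleton: "decreasing_poly [x] = [:1, 1:]"
proof -
  have "decreasing_poly ([] @ x # []) = (decreasing_poly [] + monom 1 1) * decreasing_poly []"
    by (rule decreasing_poly_split) auto
  thus ?thesis by (simp add: decreasing_poly_Nil monom_altdef one_pCons del: One_nat_def)
qed

text \<open>In degree 1 the leading coefficient is at least 2 before and after, so neither
  polynomial is monic. In higher degree the leading term is untouched.\<close>

lemma monic_of_degree_add_monom:
  assumes "coeff p 1 \<ge> 2"
  shows "monic_of_degree (p + monom 1 1) k \<longleftrightarrow> monic_of_degree p k"
proof (cases "degree p \<le> 1")
  case True
  have "degree p = 1" using True assms by (metis le_antisym le_degree not_numeral_le_zero)
  moreover have "degree (p + monom 1 1) = 1"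
    using True assms by (intro antisym degree_add_le le_degree) (auto simp: degree_monom_eq)
  ultimately show ?thesis using assms by (auto simp: monic_of_degree_def)
next
  case False
  hence "degree (p + monom 1 1) = degree p"
    by (intro degree_add_eq_left) (simp add: degree_monom_eq)
  thus ?thesis using False by (auto simp: monic_of_degree_def)
qed

lemma coeff_1_decreasing_poly_avoiders:
  assumes "\<alpha> \<in> avoiders {1..n}"
  shows "coeff (decreasing_poly \<alpha>) 1 = n"
proof -
  have "distinct \<alpha>" "length \<alpha> = n"
    using assms by (auto simp: avoiders_def permutations_of_set_def dest: distinct_card)
  thus ?thesis by (simp add: coeff_decreasing_poly_1 del: One_nat_def)
qed

text \<open>Length 0 turns \<open>1\<close> into \<open>1 + y\<close>, raising the degree; length 1
  turns \<open>1 + y\<close> into \<open>1 + 2y\<close>, which is no longer monic. The corrections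
  stand on both sides to avoid subtraction of naturals.\<close>

lemma shifted_monic_count_eq:
  "shifted_monic_count n k + of_bool (n = 0 \<and> k = 0) + of_bool (n = 1 \<and> k = 1) =
     monic_count n k + of_bool (n = 0 \<and> k = 1)"
proof -
  consider "n = 0" | "n = 1" | "n \<ge> 2" by linarith
  thus ?thesis
  proof cases
    case 1
    have "(1::nat poly) + monom 1 1 = [:1, 1:]" by (simp add: monom_altdef one_pCons del: One_nat_def)
    thus ?thesis
      unfolding 1 shifted_monic_count_def monic_count_def avoiders_0
      by (simp add: decreasing_poly_Nil monic_of_degree_def eq_commute[of _ k])
  next
    case 2
    have "[:1, 1:] + monom 1 1 = [:1, 2 :: nat:]" by (simp add: monom_altdef del: One_nat_def)
    thus ?thesis
      unfolding 2 shifted_monic_count_def monic_count_def avoiders_1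
      by (simp add: decreasing_poly_singleton monic_of_degree_def eq_commute[of _ k])
  next
    case 3
    have "shifted_monic_count n k = monic_count n k"
      unfolding shifted_monic_count_def monic_count_def
    proof (rule sum.cong[OF refl])
      fix \<alpha> assume "\<alpha> \<in> avoiders {1..n}"
      hence "coeff (decreasing_poly \<alpha>) 1 \<ge> 2" using 3 by (simp only: coeff_1_decreasing_poly_avoiders)
      thus "(of_bool (monic_of_degree (decreasing_poly \<alpha> + monom 1 1) k) :: nat) =
          of_bool (monic_of_degree (decreasing_poly \<alpha>) k)"
        by (simp only: monic_of_degree_add_monom)
    qed
    thus ?thesis using 3 by simp
  qed
qed

lemma monic_count_0_left: "monic_count 0 k = of_bool (k = 0)"
  unfolding monic_count_def avoiders_0
  by (simp add: decreasing_poly_Nil monic_of_degree_def eq_commute[of _ k])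

text \<open>The case \<open>k = 0\<close> is separate: every list contains the empty pattern exactly
  once, but only the empty permutation has a polynomial of degree 0.\<close>

lemma monic_count_eq_g132:
  "monic_count n k = (if k = 0 then of_bool (n = 0) else g132 (decreasing_pattern k) n)"
proof (cases "k = 0")
  case True
  have "monic_count n 0 = 0" if "n \<noteq> 0"
    unfolding monic_count_def
  proof (rule sum.neutral, rule ballI)
    fix \<alpha> assume "\<alpha> \<in> avoiders {1..n}"
    hence "coeff (decreasing_poly \<alpha>) 1 \<noteq> 0" using that by (simp only: coeff_1_decreasing_poly_avoiders not_False_eq_True)
    hence "1 \<le> degree (decreasing_poly \<alpha>)" by (rule le_degree)
    thus "of_bool (monic_of_degree (decreasing_poly \<alpha>) 0) = (0::nat)" by (simp add: monic_of_degree_def)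
  qed
  thus ?thesis using True by (auto simp: monic_count_0_left)
next
  case False
  have iff: "monic_of_degree (decreasing_poly \<alpha>) k \<longleftrightarrow>
      contains_exactly_once \<alpha> (decreasing_pattern k)" if "distinct \<alpha>" for \<alpha>
  proof -
    have "monic_of_degree (decreasing_poly \<alpha>) k \<longleftrightarrow>
        card (occurrences (decreasing_pattern k) \<alpha>) = 1"
      unfolding monic_of_degree_def card_occurrences_decreasing_pattern[OF that]
      using False by (intro coeff_decreasing_poly_eq_1_iff[symmetric]) simp
    thus ?thesis
      by (auto simp: contains_exactly_once_def card_1_singleton_iff)
  qed
  have "monic_count n k = card {\<alpha> \<in> avoiders {1..n}. monic_of_degree (decreasing_poly \<alpha>) k}"
    unfolding monic_count_def by (simp add: Collect_conj_eq)
  also have "{\<alpha> \<in> avoiders {1..n}. monic_of_degree (decreasing_poly \<alpha>) k} =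
      {\<alpha> \<in> permutations_of_set {1..n}. avoids \<alpha> [1, 3, 2] \<and>
         contains_exactly_once \<alpha> (decreasing_pattern k)}"
    using iff by (auto simp: avoiders_def permutations_of_set_def)
  finally show ?thesis using False by (simp add: g132_def)
qed

section \<open>Bivariate generating functions\<close>

text \<open>\<open>f n k\<close> is the coefficient of \<open>X ^ n * Y ^ k\<close>.\<close>

definition bivariate_gf :: "(nat \<Rightarrow> nat \<Rightarrow> nat) \<Rightarrow> real fls fps" where
  "bivariate_gf f = Abs_fps (\<lambda>k. fps_to_fls (Abs_fps (\<lambda>n. of_nat (f n k))))"

lemma bivariate_gf_add:
  "bivariate_gf (\<lambda>n k. f n k + g n k) = bivariate_gf f + bivariate_gf g"
  by (auto simp: bivariate_gf_def fps_eq_iff simp flip: fps_to_fls_plus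
      intro!: arg_cong[where f = fps_to_fls])

lemma bivariate_gf_mult:
  "bivariate_gf f * bivariate_gf g =
     bivariate_gf (\<lambda>n k. \<Sum>i\<le>n. \<Sum>j\<le>k. f i j * g (n - i) (k - j))"
proof (rule fps_ext)
  fix k
  \<comment> \<open>The embedding into Laurent series commutes with sums, so the comparison takes
    place among power series.\<close>
  have sum: "(\<Sum>j\<in>A. fps_to_fls (F j)) = fps_to_fls (\<Sum>j\<in>A. F j)" for A and F :: "nat \<Rightarrow> real fps"
    by (induction A rule: infinite_finite_induct) auto
  have "(bivariate_gf f * bivariate_gf g) $ k = fps_to_fls (\<Sum>j=0..k.
      Abs_fps (\<lambda>n. of_nat (f n j)) * Abs_fps (\<lambda>n. of_nat (g n (k - j))))"
    by (simp add: bivariate_gf_def fps_mult_nth fls_times_fps_to_fls sum[symmetric])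
  also have "(\<Sum>j=0..k. Abs_fps (\<lambda>n. of_nat (f n j)) * Abs_fps (\<lambda>n. of_nat (g n (k - j)))) =
      Abs_fps (\<lambda>n. of_nat (\<Sum>i\<le>n. \<Sum>j\<le>k. f i j * g (n - i) (k - j)) :: real)"
  proof (rule fps_ext)
    fix n
    have "(\<Sum>j=0..k. Abs_fps (\<lambda>n. of_nat (f n j)) * Abs_fps (\<lambda>n. of_nat (g n (k - j)) :: real)) $ n =
        (\<Sum>j\<le>k. \<Sum>i\<le>n. of_nat (f i j * g (n - i) (k - j)))"
      by (simp add: fps_sum_nth fps_mult_nth atLeast0AtMost)
    also have "\<dots> = (\<Sum>i\<le>n. \<Sum>j\<le>k. of_nat (f i j * g (n - i) (k - j)))"
      by (rule sum.swap)
    finally show "(\<Sum>j=0..k. Abs_fps (\<lambda>n. of_nat (f n j)) * Abs_fps (\<lambda>n. of_nat (g n (k - j)) :: real)) $ n =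
        Abs_fps (\<lambda>n. of_nat (\<Sum>i\<le>n. \<Sum>j\<le>k. f i j * g (n - i) (k - j))) $ n"
      by simp
  qed
  finally show "(bivariate_gf f * bivariate_gf g) $ k =
      bivariate_gf (\<lambda>n k. \<Sum>i\<le>n. \<Sum>j\<le>k. f i j * g (n - i) (k - j)) $ k"
    by (simp add: bivariate_gf_def)
qed

lemma bivariate_gf_shift:
  "X * bivariate_gf f = bivariate_gf (\<lambda>n k. if n = 0 then 0 else f (n - 1) k)"
proof (rule fps_ext)
  fix k
  have "fps_X * Abs_fps (\<lambda>n. of_nat (f n k) :: real) =
      Abs_fps (\<lambda>n. of_nat (if n = 0 then 0 else f (n - 1) k))"
    by (rule fps_ext) auto
  thus "(X * bivariate_gf f) $ k =
      bivariate_gf (\<lambda>n k. if n = 0 then 0 else f (n - 1) k) $ k"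
    by (simp add: X_def bivariate_gf_def flip: fls_times_fps_to_fls fps_X_to_fls)
qed

lemma bivariate_gf_power:
  "bivariate_gf (\<lambda>n k. of_bool (n = i \<and> k = j)) = X ^ i * Y ^ j"
proof (rule fps_ext)
  fix k
  have "Abs_fps (\<lambda>n. of_nat (of_bool (n = i \<and> k = j)) :: real) = (if k = j then fps_X ^ i else 0)"
    by (auto simp: fps_eq_iff)
  thus "bivariate_gf (\<lambda>n k. of_bool (n = i \<and> k = j)) $ k = (X ^ i * Y ^ j) $ k"
    by (auto simp: bivariate_gf_def X_def Y_def fps_to_fls_power)
qed

text \<open>The summand 1 comes from \<open>k = 0\<close>, where \<open>\<Psi>\<close> has
  coefficient 0.\<close>

lemma bivariate_gf_monic_count: "bivariate_gf monic_count = 1 + \<Psi>"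
proof (rule fps_ext)
  fix k
  have "Abs_fps (\<lambda>n. of_nat (of_bool (n = 0)) :: real) = 1" by (auto simp: fps_eq_iff)
  thus "bivariate_gf monic_count $ k = (1 + \<Psi>) $ k"
    by (simp add: bivariate_gf_def \<Psi>_def monic_count_eq_g132 G132_def)
qed

lemma bivariate_gf_shifted_monic_count:
  "bivariate_gf shifted_monic_count = \<Psi> + Y - X * Y"
proof -
  have "bivariate_gf shifted_monic_count + 1 + X * Y = 1 + \<Psi> + Y"
  proof -
    have "bivariate_gf (\<lambda>n k. shifted_monic_count n k + of_bool (n = 0 \<and> k = 0) +
          of_bool (n = 1 \<and> k = 1)) =
        bivariate_gf (\<lambda>n k. monic_count n k + of_bool (n = 0 \<and> k = 1))"
      by (simp only: shifted_monic_count_eq)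
    thus ?thesis
      by (simp only: bivariate_gf_add bivariate_gf_power bivariate_gf_monic_count) simp
  qed
  thus ?thesis by (simp add: algebra_simps)
qed

section \<open>The quadratic equation and its solution\<close>

lemma \<Psi>_functional_equation: "\<Psi> = X * (\<Psi> + Y - X * Y) * (1 + \<Psi>)"
proof -
  let ?c = "\<lambda>n k. \<Sum>i\<le>n. \<Sum>j\<le>k. shifted_monic_count i j * monic_count (n - i) (k - j)"
  \<comment> \<open>The recurrence starts at length 1; the empty permutation supplies the initial
    term.\<close>
  have "monic_count n k = of_bool (n = 0 \<and> k = 0) + (if n = 0 then 0 else ?c (n - 1) k)" for n k
    by (cases n) (auto simp: monic_count_0_left monic_count_Suc)
  hence "bivariate_gf monic_count =
      bivariate_gf (\<lambda>n k. of_bool (n = 0 \<and> k = 0) + (if n = 0 then 0 else ?c (n - 1) k))"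
    by (intro arg_cong[where f = bivariate_gf] ext)
  also have "\<dots> = 1 + X * (bivariate_gf shifted_monic_count * bivariate_gf monic_count)"
    by (simp only: bivariate_gf_add bivariate_gf_power bivariate_gf_mult bivariate_gf_shift) simp
  finally show ?thesis
    by (simp add: bivariate_gf_monic_count bivariate_gf_shifted_monic_count mult.assoc)
qed

theorem theorem3p2:
  "\<Psi> = ((1 - X) * (1 - X * Y)
          - fps_sqrt ((1 - X)\<^sup>2 * (1 - X * Y)\<^sup>2 - 4 * X\<^sup>2 * (1 - X) * Y)) / (2 * X)"
proof -
  \<comment> \<open>The candidate root: with \<open>B = (1 - X) * (1 - X * Y)\<close>, completing
    the square in the quadratic for \<open>\<Psi>\<close> makes
    \<open>(B - 2 * X * \<Psi>)\<^sup>2\<close> the discriminant.\<close>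
  let ?S = "(1 - X) * (1 - X * Y) - 2 * X * \<Psi>"
  have "X * \<Psi>\<^sup>2 - (1 - X) * (1 - X * Y) * \<Psi> + X * (1 - X) * Y = 0"
    using \<Psi>_functional_equation by algebra
  hence "?S\<^sup>2 = (1 - X)\<^sup>2 * (1 - X * Y)\<^sup>2 - 4 * X\<^sup>2 * (1 - X) * Y"
    by algebra
  \<comment> \<open>This fixes the branch: \<open>\<Psi>\<close> vanishes at \<open>Y = 0\<close>,
    leaving \<open>1 - X\<close>, whose constant term is positive.\<close>
  moreover have "?S $ 0 = fps_to_fls (1 - fps_X)"
    by (simp add: X_def Y_def \<Psi>_def fps_mult_nth)
  ultimately have "fps_sqrt ((1 - X)\<^sup>2 * (1 - X * Y)\<^sup>2 - 4 * X\<^sup>2 * (1 - X) * Y) = ?S"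
    by (rule fps_sqrt_eqI) simp
  moreover have "2 * X \<noteq> 0"
    by (simp add: X_def)
  ultimately show ?thesis by simp
qed

end
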